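(* Let $\mathbb{K}$ be a field of characteristic not $2$ and let $A=\mathfrak{d}(V,\varphi,\delta)$ be a generalized $\mathbb{K}$-oscillator Lie algebra. The following assertions are equivalent: (a) $A$ is local. (b) $A=A^2\oplus\mathbb{K}\cdot\delta$ and $\delta\neq 0$ (as a map). (c) $Z(A)$ is one-dimensional. (d) $\delta$ is an automorphism of the vector space $V$. (e) The quadratic dimension of $A$ is $2$. In this case, $A^2$ is a generalized $\mathbb{K}$-Heisenberg algebra, and the set of invariant symmetric bilinear forms of $A$ is the vector space $B^s_{inv}(A)=\operatorname{span}\langle\varphi_{1,0},\varphi_\delta\rangle$, where $\varphi_{1,0}$ is the symmetric bilinear form given by $\varphi_{1,0}(A^2,A)=0$ and $\varphi_{1,0}(\delta,\delta)=1$.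
   Context: Generalized $\mathbb{K}$-oscillator algebra: let $V$ be a finite-dimensional $\mathbb{K}$-vector space with $\dim V\ge 2$, $\varphi$ a non-degenerate symmetric bilinear form on $V$, and $\delta\colon V\to V$ a $\varphi$-skew linear map, i.e. $\varphi(\delta(x),y)=-\varphi(x,\delta(y))$. Then $\mathfrak{d}(V,\varphi,\delta)=\mathbb{K}\cdot\delta\oplus V\oplus\mathbb{K}\cdot\delta^*$, where $\delta$ and $\delta^*$ are used as basis symbols of one-dimensional spaces (the summand $\mathbb{K}\cdot\delta$ is one-dimensional even if the map $\delta$ is zero), is the Lie algebra with bracket $$[t\delta+x+s\delta^*,t'\delta+y+s'\delta^*]=t\,\delta(y)-t'\,\delta(x)+\varphi(\delta(x),y)\,\delta^*,$$ and it carries the non-degenerate invariant symmetric bilinear form $$\varphi_\delta(t\delta+x+s\delta^*,t'\delta+y+s'\delta^* )=ts'+st'+\varphi(x,y),$$ for $t,t',s,s'\in\mathbb{K}$, $x,y\in V$. A Lie algebra is local if it has exactly one maximal ideal. $A^2=[A,A]$ and $Z(A)$ is the centre. A bilinear form $\psi$ on a Lie algebra $L$ is invariant if $\psi([x,y],z)+\psi(y,[x,z])=0$ for all $x,y,z$. $B^s_{inv}(L)$ is the vector space of all (possibly degenerate) symmetric invariant bilinear forms of $L$, and the quadratic dimension of $L$ is $\dim B^s_{inv}(L)$. A generalized $\mathbb{K}$-Heisenberg algebra is a Lie algebra $\mathfrak{h}$ with $\mathfrak{h}^2=\mathbb{K}\cdot z=Z(\mathfrak{h})$ one-dimensional. 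*)

theory Defs
  imports Complex_Main "HOL-Library.Function_Algebras" "HOL-Library.Product_Plus"
begin

section \<open>Lie algebras over a field\<close>

text \<open>A Lie algebra is given by a linear subspace \<open>L\<close> of an ambient vector space together with a
  bracket that is only constrained on \<open>L\<close>, so that subalgebras (such as the derived algebra)
  carry the restricted bracket.\<close>

locale lie_algebra = vector_space scale
  for scale :: "'k::field \<Rightarrow> 'a::ab_group_add \<Rightarrow> 'a" +
  fixes br :: "'a \<Rightarrow> 'a \<Rightarrow> 'a" and L :: "'a set"
  assumes carrier_subspace: "subspace L"
    and br_closed: "\<lbrakk>x \<in> L; y \<in> L\<rbrakk> \<Longrightarrow> br x y \<in> L"
    and br_add_left: "\<lbrakk>x \<in> L; y \<in> L; z \<in> L\<rbrakk> \<Longrightarrow> br (x + y) z = br x z + br y z"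
    and br_add_right: "\<lbrakk>x \<in> L; y \<in> L; z \<in> L\<rbrakk> \<Longrightarrow> br x (y + z) = br x y + br x z"
    and br_scale_left: "\<lbrakk>x \<in> L; y \<in> L\<rbrakk> \<Longrightarrow> br (scale c x) y = scale c (br x y)"
    and br_scale_right: "\<lbrakk>x \<in> L; y \<in> L\<rbrakk> \<Longrightarrow> br x (scale c y) = scale c (br x y)"
    and br_self: "x \<in> L \<Longrightarrow> br x x = 0"
    and jacobi: "\<lbrakk>x \<in> L; y \<in> L; z \<in> L\<rbrakk>
      \<Longrightarrow> br x (br y z) + br y (br z x) + br z (br x y) = 0"

definition lie_ideal ::
    "('k::field \<Rightarrow> 'a::ab_group_add \<Rightarrow> 'a) \<Rightarrow> ('a \<Rightarrow> 'a \<Rightarrow> 'a) \<Rightarrow> 'a set \<Rightarrow> 'a set \<Rightarrow> bool" where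
  "lie_ideal scale br L I \<longleftrightarrow>
     I \<subseteq> L \<and> module.subspace scale I \<and> (\<forall>x\<in>L. \<forall>y\<in>I. br x y \<in> I)"

definition maximal_lie_ideal ::
    "('k::field \<Rightarrow> 'a::ab_group_add \<Rightarrow> 'a) \<Rightarrow> ('a \<Rightarrow> 'a \<Rightarrow> 'a) \<Rightarrow> 'a set \<Rightarrow> 'a set \<Rightarrow> bool" where
  "maximal_lie_ideal scale br L I \<longleftrightarrow>
     lie_ideal scale br L I \<and> I \<noteq> L \<and>
     (\<forall>J. lie_ideal scale br L J \<and> I \<subseteq> J \<longrightarrow> J = I \<or> J = L)"

definition local_lie_algebra ::
    "('k::field \<Rightarrow> 'a::ab_group_add \<Rightarrow> 'a) \<Rightarrow> ('a \<Rightarrow> 'a \<Rightarrow> 'a) \<Rightarrow> 'a set \<Rightarrow> bool" where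
  "local_lie_algebra scale br L \<longleftrightarrow>
     lie_algebra scale br L \<and> (\<exists>!I. maximal_lie_ideal scale br L I)"

definition lie_derived ::
    "('k::field \<Rightarrow> 'a::ab_group_add \<Rightarrow> 'a) \<Rightarrow> ('a \<Rightarrow> 'a \<Rightarrow> 'a) \<Rightarrow> 'a set \<Rightarrow> 'a set" where
  "lie_derived scale br L = module.span scale {br x y | x y. x \<in> L \<and> y \<in> L}"

definition lie_centre :: "('a \<Rightarrow> 'a \<Rightarrow> 'a::zero) \<Rightarrow> 'a set \<Rightarrow> 'a set" where
  "lie_centre br L = {z \<in> L. \<forall>x\<in>L. br z x = 0}"

definition generalized_heisenberg ::
    "('k::field \<Rightarrow> 'a::ab_group_add \<Rightarrow> 'a) \<Rightarrow> ('a \<Rightarrow> 'a \<Rightarrow> 'a) \<Rightarrow> 'a set \<Rightarrow> bool" where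
  "generalized_heisenberg scale br H \<longleftrightarrow>
     lie_algebra scale br H \<and>
     (\<exists>z. z \<noteq> 0 \<and> lie_derived scale br H = module.span scale {z} \<and>
          lie_centre br H = module.span scale {z})"

definition direct_sum_decomp :: "'a::ab_group_add set \<Rightarrow> 'a set \<Rightarrow> 'a set \<Rightarrow> bool" where
  "direct_sum_decomp A U W \<longleftrightarrow> A = {u + w | u w. u \<in> U \<and> w \<in> W} \<and> U \<inter> W = {0}"


section \<open>Symmetric bilinear forms\<close>

definition sym_bilinear_form ::
    "('k::field \<Rightarrow> 'a::ab_group_add \<Rightarrow> 'a) \<Rightarrow> ('a \<Rightarrow> 'a \<Rightarrow> 'k) \<Rightarrow> bool" where
  "sym_bilinear_form scale \<psi> \<longleftrightarrow>
     (\<forall>x. Vector_Spaces.linear scale (*) (\<lambda>y. \<psi> x y)) \<and>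
     (\<forall>y. Vector_Spaces.linear scale (*) (\<lambda>x. \<psi> x y)) \<and>
     (\<forall>x y. \<psi> x y = \<psi> y x)"

definition nondegenerate :: "('a::zero \<Rightarrow> 'a \<Rightarrow> 'k::zero) \<Rightarrow> bool" where
  "nondegenerate \<psi> \<longleftrightarrow> (\<forall>x. (\<forall>y. \<psi> x y = 0) \<longrightarrow> x = 0)"

definition invariant_form ::
    "('a \<Rightarrow> 'a \<Rightarrow> 'a) \<Rightarrow> ('a \<Rightarrow> 'a \<Rightarrow> 'k::ab_group_add) \<Rightarrow> bool" where
  "invariant_form br \<psi> \<longleftrightarrow> (\<forall>x y z. \<psi> (br x y) z + \<psi> y (br x z) = 0)"

text \<open>The space of invariant symmetric bilinear forms of a Lie algebra whose carrier is the whole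
  type; addition of forms is the pointwise one.\<close>

definition inv_sym_forms ::
    "('k::field \<Rightarrow> 'a::ab_group_add \<Rightarrow> 'a) \<Rightarrow> ('a \<Rightarrow> 'a \<Rightarrow> 'a) \<Rightarrow> ('a \<Rightarrow> 'a \<Rightarrow> 'k) set" where
  "inv_sym_forms scale br = {\<psi>. sym_bilinear_form scale \<psi> \<and> invariant_form br \<psi>}"

definition form_scale :: "'k::field \<Rightarrow> ('a \<Rightarrow> 'a \<Rightarrow> 'k) \<Rightarrow> ('a \<Rightarrow> 'a \<Rightarrow> 'k)" where
  "form_scale c \<psi> = (\<lambda>x y. c * \<psi> x y)"

lemma vector_space_form_scale: "vector_space form_scale"
  by standard (auto simp: form_scale_def fun_eq_iff algebra_simps)

definition quadratic_dim ::
    "('k::field \<Rightarrow> 'a::ab_group_add \<Rightarrow> 'a) \<Rightarrow> ('a \<Rightarrow> 'a \<Rightarrow> 'a) \<Rightarrow> nat" where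
  "quadratic_dim scale br = vector_space.dim form_scale (inv_sym_forms scale br)"


section \<open>Generalized oscillator algebras\<close>

locale generalized_oscillator = vector_space scale
  for scale :: "'k::field \<Rightarrow> 'v::ab_group_add \<Rightarrow> 'v" +
  fixes \<phi> :: "'v \<Rightarrow> 'v \<Rightarrow> 'k" and \<delta> :: "'v \<Rightarrow> 'v"
  assumes fin_dim: "\<exists>B. finite_dimensional_vector_space scale B"
    and dim_ge_2: "2 \<le> dim UNIV"
    and form: "sym_bilinear_form scale \<phi>"
    and nondeg: "nondegenerate \<phi>"
    and lin: "Vector_Spaces.linear scale scale \<delta>"
    and skew: "\<phi> (\<delta> x) y = - \<phi> x (\<delta> y)"

text \<open>The triple \<open>(t, x, s)\<close> stands for \<open>t\<delta> + x + s\<delta>\<^sup>*\<close>; the symbols \<open>\<delta>\<close> and \<open>\<delta>\<^sup>*\<close>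
  are thus \<open>(1, 0, 0)\<close> and \<open>(0, 0, 1)\<close>, also when the map \<open>\<delta>\<close> is zero.\<close>

definition osc_scale ::
    "('k::field \<Rightarrow> 'v::ab_group_add \<Rightarrow> 'v) \<Rightarrow> 'k \<Rightarrow> 'k \<times> 'v \<times> 'k \<Rightarrow> 'k \<times> 'v \<times> 'k" where
  "osc_scale scale c = (\<lambda>(t, x, s). (c * t, scale c x, c * s))"

definition osc_bracket ::
    "('k::field \<Rightarrow> 'v::ab_group_add \<Rightarrow> 'v) \<Rightarrow> ('v \<Rightarrow> 'v \<Rightarrow> 'k) \<Rightarrow> ('v \<Rightarrow> 'v)
     \<Rightarrow> 'k \<times> 'v \<times> 'k \<Rightarrow> 'k \<times> 'v \<times> 'k \<Rightarrow> 'k \<times> 'v \<times> 'k" where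
  "osc_bracket scale \<phi> \<delta> = (\<lambda>(t, x, s) (t', y, s').
     (0, scale t (\<delta> y) - scale t' (\<delta> x), \<phi> (\<delta> x) y))"

definition osc_form ::
    "('v \<Rightarrow> 'v \<Rightarrow> 'k::field) \<Rightarrow> 'k \<times> 'v \<times> 'k \<Rightarrow> 'k \<times> 'v \<times> 'k \<Rightarrow> 'k" where
  "osc_form \<phi> = (\<lambda>(t, x, s) (t', y, s'). t * s' + s * t' + \<phi> x y)"

definition osc_delta :: "'k::field \<times> 'v::ab_group_add \<times> 'k" where
  "osc_delta = (1, 0, 0)"

text \<open>The defining property of \<open>\<phi>\<^sub>1\<^sub>,\<^sub>0\<close>: it vanishes on \<open>A\<^sup>2 \<times> A\<close> and takes the
  value 1 at \<open>(\<delta>, \<delta>)\<close>. It determines the form uniquely when \<open>A = A\<^sup>2 \<oplus> K\<delta>\<close>.\<close>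

definition is_phi_1_0 ::
    "('k::field \<Rightarrow> 'v::ab_group_add \<Rightarrow> 'v) \<Rightarrow> ('v \<Rightarrow> 'v \<Rightarrow> 'k) \<Rightarrow> ('v \<Rightarrow> 'v)
     \<Rightarrow> ('k \<times> 'v \<times> 'k \<Rightarrow> 'k \<times> 'v \<times> 'k \<Rightarrow> 'k) \<Rightarrow> bool" where
  "is_phi_1_0 scale \<phi> \<delta> \<psi> \<longleftrightarrow>
     sym_bilinear_form (osc_scale scale) \<psi> \<and>
     (\<forall>a \<in> lie_derived (osc_scale scale) (osc_bracket scale \<phi> \<delta>) UNIV. \<forall>b. \<psi> a b = 0) \<and>
     \<psi> osc_delta osc_delta = 1"

context generalized_oscillator
begin

lemma vector_space_osc: "vector_space (osc_scale scale)"
  by standard (auto simp: osc_scale_def algebra_simps scale_right_distrib scale_left_distrib)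

lemma delta_add: "\<delta> (x + y) = \<delta> x + \<delta> y"
  and delta_scale: "\<delta> (scale c x) = scale c (\<delta> x)"
  and delta_diff: "\<delta> (x - y) = \<delta> x - \<delta> y"
proof -
  interpret l: Vector_Spaces.linear scale scale \<delta> by (rule lin)
  show "\<delta> (x + y) = \<delta> x + \<delta> y" "\<delta> (scale c x) = scale c (\<delta> x)" "\<delta> (x - y) = \<delta> x - \<delta> y"
    by (simp_all add: l.add l.scale l.diff)
qed

lemma form_sym: "\<phi> x y = \<phi> y x"
  using form by (simp add: sym_bilinear_form_def)

lemma form_right:
  shows "\<phi> x (y + z) = \<phi> x y + \<phi> x z" "\<phi> x (y - z) = \<phi> x y - \<phi> x z"
    "\<phi> x (scale c y) = c * \<phi> x y" "\<phi> x 0 = 0"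
proof -
  interpret l: Vector_Spaces.linear scale "(*)" "\<lambda>y. \<phi> x y"
    using form by (simp add: sym_bilinear_form_def)
  show "\<phi> x (y + z) = \<phi> x y + \<phi> x z" "\<phi> x (y - z) = \<phi> x y - \<phi> x z"
    "\<phi> x (scale c y) = c * \<phi> x y" "\<phi> x 0 = 0"
    by (simp_all add: l.add l.scale l.diff l.zero)
qed

lemma form_left:
  shows "\<phi> (x + y) z = \<phi> x z + \<phi> y z" "\<phi> (x - y) z = \<phi> x z - \<phi> y z"
    "\<phi> (scale c x) z = c * \<phi> x z" "\<phi> 0 z = 0"
  by (simp_all add: form_sym[of _ z] form_right)

text \<open>Characteristic 2 has to be excluded for the bracket to be alternating.\<close>

lemma oscillator_lie_algebra:
  assumes "CHAR('k) \<noteq> 2"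
  shows "lie_algebra (osc_scale scale) (osc_bracket scale \<phi> \<delta>) UNIV"
proof -
  interpret osc: vector_space "osc_scale scale" by (rule vector_space_osc)
  have two: "(2::'k) \<noteq> 0"
  proof
    assume "(2::'k) = 0"
    then have "CHAR('k) dvd 2"
      by (metis of_nat_eq_0_iff_char_dvd of_nat_numeral)
    moreover have "CHAR('k) \<noteq> 1"
      using of_nat_eq_0_iff_char_dvd[where ?'a = 'k, of 1] by auto
    moreover have "CHAR('k) \<noteq> 0"
      using \<open>CHAR('k) dvd 2\<close> by (intro notI) simp
    moreover have "CHAR('k) \<le> 2"
      using \<open>CHAR('k) dvd 2\<close> by (rule dvd_imp_le) simp
    ultimately show False using assms by linarith
  qed
  have alt: "\<phi> (\<delta> x) x = 0" for x
  proof -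
    have "\<phi> (\<delta> x) x = - \<phi> (\<delta> x) x" using skew[of x x] form_sym[of x "\<delta> x"] by simp
    then have "2 * \<phi> (\<delta> x) x = 0" unfolding mult_2 by (rule eq_neg_iff_add_eq_0[THEN iffD1])
    then show ?thesis using two by simp
  qed
  show ?thesis
  proof (unfold_locales, goal_cases)
    case 1 show ?case by (rule osc.subspace_UNIV)
  next
    case (8 x y z)
    obtain t a u where x: "x = (t, a, u)" by (cases x)
    obtain t' b u' where y: "y = (t', b, u')" by (cases y)
    obtain t'' c u'' where z: "z = (t'', c, u'')" by (cases z)
    have e: "\<phi> (\<delta> p) (\<delta> q) = \<phi> (\<delta> q) (\<delta> p)" for p q by (rule form_sym)
    show ?case
      unfolding x y z
      by (simp add: osc_bracket_def zero_prod_def form_right delta_diff delta_scale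
          scale_right_diff_distrib e[of b a] e[of c a] e[of c b] mult.commute algebra_simps)
  qed (auto simp: osc_bracket_def osc_scale_def alt delta_add delta_scale form_right form_left
        scale_right_distrib scale_left_distrib scale_right_diff_distrib zero_prod_def
        algebra_simps)
qed

lemma osc_form_sym_bilinear: "sym_bilinear_form (osc_scale scale) (osc_form \<phi>)"
proof -
  have vs: "vector_space ((*) :: 'k \<Rightarrow> 'k \<Rightarrow> 'k)"
    by standard (auto simp: algebra_simps)
  show ?thesis
    unfolding sym_bilinear_form_def Vector_Spaces.linear_def module_hom_def module_hom_axioms_def
    by (auto simp: vs vector_space_osc vector_space_osc[unfolded module_iff_vector_space[symmetric]]
        vs[unfolded module_iff_vector_space[symmetric]]
        osc_form_def osc_scale_def form_left form_right algebra_simps intro: form_sym)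
qed

lemma osc_form_invariant: "invariant_form (osc_bracket scale \<phi> \<delta>) (osc_form \<phi>)"
proof -
  have key: "\<phi> y (\<delta> x) * t + t * \<phi> x (\<delta> y) = 0" for t x y
  proof -
    have "\<phi> y (\<delta> x) = - \<phi> x (\<delta> y)"
      unfolding form_sym[of y "\<delta> x"] by (rule skew)
    then show ?thesis by simp
  qed
  show ?thesis
    unfolding invariant_form_def
  proof (intro allI)
    fix a b c :: "'k \<times> 'v \<times> 'k"
    obtain t x s where a: "a = (t, x, s)" by (cases a)
    obtain t' y s' where b: "b = (t', y, s')" by (cases b)
    obtain t'' z s'' where c: "c = (t'', z, s'')" by (cases c)
    show "osc_form \<phi> (osc_bracket scale \<phi> \<delta> a b) c
        + osc_form \<phi> b (osc_bracket scale \<phi> \<delta> a c) = 0"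
      using key[of y x t''] key[of x z t'] key[of z y t]
      unfolding a b c
      by (simp add: osc_form_def osc_bracket_def form_left form_right skew
          algebra_simps eq_neg_iff_add_eq_0 neg_eq_iff_add_eq_0)
  qed
qed

lemma osc_form_nondegenerate: "nondegenerate (osc_form \<phi>)"
  unfolding nondegenerate_def
proof (intro allI impI)
  fix a :: "'k \<times> 'v \<times> 'k"
  assume h: "\<forall>b. osc_form \<phi> a b = 0"
  obtain t x s where a: "a = (t, x, s)" by (cases a)
  have "t = 0" using h[rule_format, of "(0, 0, 1)"] by (simp add: a osc_form_def form_right)
  moreover have "s = 0" using h[rule_format, of "(1, 0, 0)"] by (simp add: a osc_form_def form_right)
  moreover have "\<phi> x y = 0" for y
    using h[rule_format, of "(0, y, 0)"] by (simp add: a osc_form_def)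
  ultimately show "a = 0" using nondeg by (auto simp: a nondegenerate_def zero_prod_def)
qed

end

end

theory Submission
  imports Defs
begin

text \<open>
  Everything is compared with the bijectivity of \<open>\<delta>\<close>. The tool for one direction is a character
  of a Lie algebra, that is, a linear functional that vanishes on all brackets. A nonzero character
  has a maximal ideal as its kernel, and the square of a character is an invariant symmetric form.
  The oscillator algebra always has the character \<open>(t, x, s) \<mapsto> t\<close>.

  Suppose that \<open>\<delta>\<close> is not bijective. As \<open>V\<close> is finite-dimensional, there is \<open>v \<noteq> 0\<close> with
  \<open>\<delta> v = 0\<close>, and by skewness \<open>x \<mapsto> \<phi>(v, x)\<close> vanishes on the image of \<open>\<delta>\<close>. This gives
  a second, independent character \<open>(t, x, s) \<mapsto> \<phi>(v, x)\<close> and with it a second maximal ideal, a third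
  invariant form besides \<open>\<phi>\<^sub>1\<^sub>,\<^sub>0\<close> and \<open>\<phi>\<^sub>\<delta>\<close>, and a nonzero functional that
  vanishes on \<open>A\<^sup>2\<close> and on the symbol \<open>\<delta>\<close>. Moreover \<open>v\<close> is central and
  independent of \<open>\<delta>\<^sup>*\<close>. So each of the other four conditions fails
  (\<open>kernel_vector_refutes\<close>).

  Suppose that \<open>\<delta>\<close> is bijective. Then \<open>A\<^sup>2\<close> is the hyperplane \<open>V \<oplus> K\<delta>\<^sup>*\<close>, a
  maximal ideal. An ideal that contains some element outside it contains the brackets of that
  element with \<open>V\<close>, and hence \<open>\<delta>\<^sup>*\<close>, all of \<open>V\<close> and finally \<open>\<delta>\<close>; so this maximal
  ideal is the only one. For an invariant symmetric form \<open>\<psi>\<close>, writing the elements of \<open>A\<^sup>2\<close> as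
  brackets shows that \<open>\<psi>\<close> agrees with \<open>\<psi>(\<delta>, \<delta>\<^sup>*) \<phi>\<^sub>\<delta>\<close> on \<open>A\<^sup>2 \<times> A\<close>, and
  the difference is a form that lives on the line \<open>A/A\<^sup>2\<close>, a multiple of
  \<open>\<phi>\<^sub>1\<^sub>,\<^sub>0\<close> (\<open>inv_sym_forms_eq_span\<close>).
\<close>

section \<open>Linear algebra\<close>

text \<open>The function \<open>dim\<close> is \<open>0\<close> on infinite-dimensional sets, so a bound on independent sets can only be
  read off from a positive dimension.\<close>

lemma (in vector_space) independent_card_le_pos_dim:
  assumes "independent S" "S \<subseteq> V" "0 < dim V"
  shows "card S \<le> dim V"
proof -
  obtain B where B: "V \<subseteq> span B" "card B = dim V"
    by (rule basis_exists)
  have "finite B" using B(2) assms(3) by (metis card.infinite less_irrefl)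
  then show ?thesis
    using independent_span_bound[of B S] assms(1,2) B by auto
qed

lemma (in vector_space) independent_pairI:
  assumes "b \<noteq> 0" "\<And>k. a \<noteq> scale k b"
  shows "independent {a, b}" "a \<noteq> b"
proof -
  show "a \<noteq> b" using assms(2)[of 1] by auto
  then show "independent {a, b}"
    using assms by (auto simp: independent_insert span_singleton)
qed

lemma vector_space_mult: "vector_space ((*) :: 'k::field \<Rightarrow> 'k \<Rightarrow> 'k)"
  by standard (auto simp: algebra_simps)

lemma sym_bilinear_form_iff:
  "sym_bilinear_form scale \<psi> \<longleftrightarrow> vector_space scale \<and>
     (\<forall>x y z. \<psi> (x + y) z = \<psi> x z + \<psi> y z) \<and> (\<forall>c x z. \<psi> (scale c x) z = c * \<psi> x z) \<and>
     (\<forall>x y. \<psi> x y = \<psi> y x)"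
    (is "?L \<longleftrightarrow> ?R")
proof
  assume ?L
  then show ?R unfolding sym_bilinear_form_def Vector_Spaces.linear_iff by blast
next
  assume R: ?R
  then have "\<forall>x y. \<psi> x y = \<psi> y x" by blast
  then have "\<psi> z (x + y) = \<psi> z x + \<psi> z y" "\<psi> z (scale c x) = c * \<psi> z x" for x y z c
    using R by (metis (no_types, lifting))+
  then show ?L
    using R by (auto simp: sym_bilinear_form_def Vector_Spaces.linear_iff vector_space_mult)
qed

lemma subspace_inv_sym_forms:
  assumes "vector_space scale"
  shows "module.subspace form_scale (inv_sym_forms scale br)"
proof -
  interpret fs: vector_space form_scale by (rule vector_space_form_scale)
  show ?thesis
  proof (rule fs.subspaceI)
    show "0 \<in> inv_sym_forms scale br"
      using assms by (simp add: inv_sym_forms_def sym_bilinear_form_iff invariant_form_def)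
  next
    fix \<psi> \<chi> assume "\<psi> \<in> inv_sym_forms scale br" "\<chi> \<in> inv_sym_forms scale br"
    then have h: "sym_bilinear_form scale \<psi>" "sym_bilinear_form scale \<chi>"
        and i: "\<psi> (br x y) z + \<psi> y (br x z) = 0" "\<chi> (br x y) z + \<chi> y (br x z) = 0" for x y z
      by (auto simp: inv_sym_forms_def invariant_form_def)
    have "(\<psi> + \<chi>) (br x y) z + (\<psi> + \<chi>) y (br x z) = 0" for x y z
    proof -
      have "(\<psi> + \<chi>) (br x y) z + (\<psi> + \<chi>) y (br x z)
          = (\<psi> (br x y) z + \<psi> y (br x z)) + (\<chi> (br x y) z + \<chi> y (br x z))"
        by (simp add: algebra_simps)
      then show ?thesis using i by simp
    qed
    moreover have "sym_bilinear_form scale (\<psi> + \<chi>)"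
      using h unfolding sym_bilinear_form_iff
      by (elim conjE, intro conjI allI) (simp_all add: algebra_simps)
    ultimately show "\<psi> + \<chi> \<in> inv_sym_forms scale br"
      by (simp add: inv_sym_forms_def invariant_form_def)
  next
    fix c \<psi> assume "\<psi> \<in> inv_sym_forms scale br"
    then have h: "sym_bilinear_form scale \<psi>"
        and i: "\<psi> (br x y) z + \<psi> y (br x z) = 0" for x y z
      by (auto simp: inv_sym_forms_def invariant_form_def)
    have "form_scale c \<psi> (br x y) z + form_scale c \<psi> y (br x z) = 0" for x y z
      using i[of x y z] by (simp add: form_scale_def flip: distrib_left)
    moreover have "sym_bilinear_form scale (form_scale c \<psi>)"
      using h unfolding sym_bilinear_form_iff form_scale_def
      by (elim conjE, intro conjI allI) (simp_all add: algebra_simps)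
    ultimately show "form_scale c \<psi> \<in> inv_sym_forms scale br"
      by (simp add: inv_sym_forms_def invariant_form_def)
  qed
qed

section \<open>Characters of Lie algebras\<close>

definition lie_character ::
    "('k::field \<Rightarrow> 'a::ab_group_add \<Rightarrow> 'a) \<Rightarrow> ('a \<Rightarrow> 'a \<Rightarrow> 'a) \<Rightarrow> ('a \<Rightarrow> 'k) \<Rightarrow> bool" where
  "lie_character scale br f \<longleftrightarrow>
     Vector_Spaces.linear scale (*) f \<and> (\<forall>x y. f (br x y) = 0)"

lemma lie_characterD:
  assumes "lie_character scale br f"
  shows "vector_space scale" "f (x + y) = f x + f y" "f (scale c x) = c * f x" "f (br x y) = 0"
    "f 0 = 0"
proof -
  interpret f: Vector_Spaces.linear scale "(*)" f
    using assms by (simp add: lie_character_def)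
  show "vector_space scale" by (rule f.vs1.vector_space_axioms)
  show "f (x + y) = f x + f y" by (rule f.add)
  show "f (scale c x) = c * f x" by (rule f.scale)
  show "f (br x y) = 0" using assms by (simp add: lie_character_def)
  show "f 0 = 0" by (rule f.zero)
qed

text \<open>The kernel contains all brackets, so it is an ideal, and it is a hyperplane, so no proper
  subspace is larger.\<close>

lemma lie_character_kernel_maximal:
  assumes f: "lie_character scale br f" and e: "f e \<noteq> 0"
  shows "maximal_lie_ideal scale br UNIV {x. f x = 0}"
proof -
  interpret vector_space scale using lie_characterD(1)[OF f] .
  have ideal: "lie_ideal scale br UNIV {x. f x = 0}"
    by (auto simp: lie_ideal_def lie_characterD[OF f] intro!: subspaceI)
  have "J = {x. f x = 0} \<or> J = UNIV" if J: "lie_ideal scale br UNIV J" "{x. f x = 0} \<subseteq> J" for J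
  proof (cases "J \<subseteq> {x. f x = 0}")
    case True
    then show ?thesis using J(2) by blast
  next
    case False
    have sub: "subspace J" using J(1) by (simp add: lie_ideal_def)
    from False obtain w where w: "w \<in> J" "f w \<noteq> 0" by blast
    have "x \<in> J" for x
    proof -
      have "f (x + scale (- (f x / f w)) w) = 0"
        using w(2) by (simp only: lie_characterD(2,3)[OF f]) simp
      then have "x + scale (- (f x / f w)) w \<in> J" using J(2) by blast
      from subspace_add[OF sub this subspace_scale[OF sub w(1), of "f x / f w"]]
      show ?thesis by (simp add: scale_minus_left)
    qed
    then show ?thesis by blast
  qed
  then show ?thesis using ideal e by (auto simp: maximal_lie_ideal_def)
qed

lemma lie_character_square:
  assumes "lie_character scale br f"
  shows "(\<lambda>x y. f x * f y) \<in> inv_sym_forms scale br"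
  by (auto simp: inv_sym_forms_def sym_bilinear_form_iff invariant_form_def algebra_simps
      lie_characterD[OF assms])

lemma lie_character_derived:
  assumes f: "lie_character scale br f" and a: "a \<in> lie_derived scale br L"
  shows "f a = 0"
proof -
  interpret vector_space scale using lie_characterD(1)[OF f] .
  have "span {br x y |x y. x \<in> L \<and> y \<in> L} \<subseteq> {x. f x = 0}"
    by (rule span_minimal) (auto simp: lie_characterD[OF f] intro!: subspaceI)
  then show ?thesis using a by (auto simp: lie_derived_def)
qed

lemma lie_subalgebra:
  assumes "lie_algebra scale br L" "H \<subseteq> L" "module.subspace scale H"
    and "\<And>x y. \<lbrakk>x \<in> H; y \<in> H\<rbrakk> \<Longrightarrow> br x y \<in> H"
  shows "lie_algebra scale br H"
proof -
  interpret lie_algebra scale br L by fact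
  show ?thesis
    by unfold_locales
      (use assms in \<open>auto simp: br_add_left br_add_right br_scale_left br_scale_right br_self jacobi
         subset_iff\<close>)
qed

section \<open>The oscillator algebra\<close>

context generalized_oscillator
begin

abbreviation "sc \<equiv> osc_scale scale"
abbreviation "br \<equiv> osc_bracket scale \<phi> \<delta>"

sublocale osc: vector_space sc
  by (rule vector_space_osc)

sublocale forms: vector_space "form_scale :: 'k \<Rightarrow> ('k \<times> 'v \<times> 'k \<Rightarrow> 'k \<times> 'v \<times> 'k \<Rightarrow> 'k) \<Rightarrow> _"
  by (rule vector_space_form_scale)

lemma sc_simps [simp]: "sc c (t, x, s) = (c * t, scale c x, c * s)"
  by (simp add: osc_scale_def)

lemma br_simps [simp]:
  "br (t, x, s) (t', y, s') = (0, scale t (\<delta> y) - scale t' (\<delta> x), \<phi> (\<delta> x) y)"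
  by (simp add: osc_bracket_def)

lemma delta_0 [simp]: "\<delta> 0 = 0"
  using delta_diff[of 0 0] by simp

declare form_right(4) [simp] form_left(4) [simp]

lemma nonzero_pairing:
  assumes "v \<noteq> 0"
  obtains y where "\<phi> v y = 1"
proof -
  obtain y where y: "\<phi> v y \<noteq> 0"
    using assms nondeg by (auto simp: nondegenerate_def)
  then have "\<phi> v (scale (1 / \<phi> v y) y) = 1" by (simp add: form_right)
  then show ?thesis by (rule that)
qed

lemma nonzero_vector:
  obtains x :: 'v where "x \<noteq> 0"
proof (cases "\<exists>x::'v. x \<noteq> 0")
  case False
  then have "(UNIV :: 'v set) \<subseteq> span {}" by auto
  then have "dim (UNIV :: 'v set) \<le> card ({} :: 'v set)" by (rule dim_le_card) simp
  then show ?thesis using dim_ge_2 by simp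
qed (use that in blast)

lemma bij_delta_iff: "bij \<delta> \<longleftrightarrow> (\<forall>v. \<delta> v = 0 \<longrightarrow> v = 0)"
proof -
  obtain B where "finite_dimensional_vector_space scale B" using fin_dim by blast
  then interpret fd: finite_dimensional_vector_space scale B .
  interpret l: Vector_Spaces.linear scale scale \<delta> by (rule lin)
  show ?thesis
    using fd.linear_inj_imp_surj[OF lin] l.inj_iff_eq_0 by (auto simp: bij_def)
qed

lemma fst_character: "lie_character sc br fst"
  unfolding lie_character_def Vector_Spaces.linear_iff
  by (auto simp: vector_space_mult osc.vector_space_axioms)

text \<open>Skewness gives \<open>\<phi>(v, \<delta> x) = -\<phi>(\<delta> v, x) = 0\<close>.\<close>

lemma kernel_character:
  assumes "\<delta> v = 0"
  shows "lie_character sc br (\<lambda>(t, x, s). \<phi> v x)"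
proof -
  have "\<phi> v (\<delta> x) = 0" for x using skew[of v x] assms by simp
  then show ?thesis
    unfolding lie_character_def Vector_Spaces.linear_iff
    by (auto simp: vector_space_mult osc.vector_space_axioms form_right)
qed

section \<open>A kernel vector refutes the other conditions\<close>

text \<open>The two characters \<open>(t, x, s) \<mapsto> t\<close> and \<open>(t, x, s) \<mapsto> \<phi>(v, x)\<close> are linearly independent.
  Their kernels are distinct maximal ideals, their squares are linearly independent modulo
  \<open>\<phi>\<^sub>\<delta>\<close>, and the second one separates \<open>A\<close> from \<open>A\<^sup>2 + K\<delta>\<close>.\<close>

lemma kernel_vector_refutes:
  assumes v: "v \<noteq> 0" "\<delta> v = 0"
  shows "\<not> local_lie_algebra sc br UNIV"
    and "\<not> direct_sum_decomp UNIV (lie_derived sc br UNIV) (osc.span {osc_delta})"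
    and "osc.dim (lie_centre br UNIV) \<noteq> 1"
    and "quadratic_dim sc br \<noteq> 2"
proof -
  obtain y where y: "\<phi> v y = 1" using v(1) by (rule nonzero_pairing)
  define f where "f = (\<lambda>(t::'k, x, s::'k). \<phi> v x)"
  have f: "lie_character sc br f" unfolding f_def using v(2) by (rule kernel_character)
  have fy: "f (0, y, 0) = 1" and fd: "f (1, 0, 0) = 0" by (auto simp: f_def y)
  have max: "maximal_lie_ideal sc br UNIV {a. fst a = 0}"
      "maximal_lie_ideal sc br UNIV {a. f a = 0}"
    using lie_character_kernel_maximal[OF fst_character, of "(1, 0, 0)"]
      lie_character_kernel_maximal[OF f, of "(0, y, 0)"] fy by simp_all
  have "(1, 0, 0) \<in> {a. f a = 0}" "(1, 0, 0) \<notin> {a :: 'k \<times> 'v \<times> 'k. fst a = 0}" using fd by auto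
  then have "{a :: 'k \<times> 'v \<times> 'k. fst a = 0} \<noteq> {a. f a = 0}" by blast
  with max show "\<not> local_lie_algebra sc br UNIV"
    unfolding local_lie_algebra_def by blast

  show "\<not> direct_sum_decomp UNIV (lie_derived sc br UNIV) (osc.span {osc_delta})"
  proof
    assume "direct_sum_decomp UNIV (lie_derived sc br UNIV) (osc.span {osc_delta})"
    then obtain u w where u: "u \<in> lie_derived sc br UNIV" and w: "w \<in> osc.span {osc_delta}"
      and "(0, y, 0) = u + w"
      unfolding direct_sum_decomp_def by blast
    then have "1 = f u + f w" using fy lie_characterD(2)[OF f, of u w] by simp
    moreover have "f w = 0"
      using w fd
      by (auto simp: osc.span_singleton osc_delta_def lie_characterD[OF f] simp del: sc_simps)
    ultimately show False using lie_character_derived[OF f u] by simp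
  qed

  show "osc.dim (lie_centre br UNIV) \<noteq> 1"
  proof
    assume 1: "osc.dim (lie_centre br UNIV) = 1"
    have "{(0, v, 0), (0, 0, 1)} \<subseteq> lie_centre br UNIV"
      by (auto simp: lie_centre_def zero_prod_def v)
    moreover have "osc.independent {(0, v, 0), (0, 0, 1)}" "(0 :: 'k, v, 0) \<noteq> (0, 0, 1 :: 'k)"
      by (rule osc.independent_pairI; simp add: zero_prod_def v(1))+
    ultimately show False
      using osc.independent_card_le_pos_dim[of "{(0, v, 0), (0, 0, 1)}" "lie_centre br UNIV"] 1
      by simp
  qed

  show "quadratic_dim sc br \<noteq> 2"
  proof
    assume 2: "quadratic_dim sc br = 2"
    define T where "T = (\<lambda>(a :: 'k \<times> 'v \<times> 'k) (b :: 'k \<times> 'v \<times> 'k). fst a * fst b)"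
    define F where "F = (\<lambda>a b. f a * f b)"
    have sub: "{osc_form \<phi>, T, F} \<subseteq> inv_sym_forms sc br"
      using lie_character_square[OF f] lie_character_square[OF fst_character]
        osc_form_sym_bilinear osc_form_invariant
      by (auto simp: T_def F_def inv_sym_forms_def)
    have "F (0, y, 0) (0, y, 0) \<noteq> 0" by (simp add: F_def fy)
    then have F0: "F \<noteq> 0" by auto
    have "T (1, 0, 0) (1, 0, 0) \<noteq> form_scale k F (1, 0, 0) (1, 0, 0)" for k
      by (simp add: T_def F_def form_scale_def fd)
    then have TF: "T \<noteq> form_scale k F" for k by metis
    have ind2: "forms.independent {T, F}" "T \<noteq> F"
      using F0 TF by (rule forms.independent_pairI)+
    \<comment> \<open>Both squares vanish at the pair of \<open>\<delta>\<close> and \<open>\<delta>\<^sup>*\<close>, where \<open>\<phi>\<^sub>\<delta>\<close> is \<open>1\<close>.\<close>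
    have "\<chi> (1, 0, 0) (0, 0, 1) = 0" if \<chi>: "\<chi> \<in> forms.span {T, F}" for \<chi>
    proof -
      obtain k l where "\<chi> - form_scale k T = form_scale l F"
        using \<chi> unfolding forms.span_insert[of T "{F}"] forms.span_singleton by blast
      then have "(\<chi> - form_scale k T) (1, 0, 0) (0, 0, 1) = form_scale l F (1, 0, 0) (0, 0, 1)"
        by simp
      then show ?thesis by (simp add: T_def F_def form_scale_def fd)
    qed
    moreover have "osc_form \<phi> (1, 0, 0) (0, 0, 1) \<noteq> 0" by (simp add: osc_form_def)
    ultimately have notin: "osc_form \<phi> \<notin> forms.span {T, F}" by blast
    then have "osc_form \<phi> \<notin> {T, F}" using forms.span_superset by blast
    with ind2 notin have "forms.independent {osc_form \<phi>, T, F}" "card {osc_form \<phi>, T, F} = 3"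
      by (auto simp: forms.independent_insert)
    then show False
      using forms.independent_card_le_pos_dim[OF _ sub] 2 by (simp add: quadratic_dim_def)
  qed
qed

section \<open>The case of a bijective map\<close>

lemma hyperplane_eq_span_delta:
  "direct_sum_decomp UNIV {a. fst a = 0} (osc.span {osc_delta})"
proof -
  have "\<exists>u w. a = u + w \<and> fst u = 0 \<and> w \<in> osc.span {osc_delta}" for a :: "'k \<times> 'v \<times> 'k"
  proof (cases a)
    case (fields t x s)
    have "a = (0, x, s) + sc t osc_delta" by (simp add: fields osc_delta_def)
    moreover have "sc t osc_delta \<in> osc.span {osc_delta}"
      by (simp add: osc.span_base osc.span_scale)
    ultimately show ?thesis by (metis fst_conv)
  qed
  moreover have "{a. fst a = 0} \<inter> osc.span {osc_delta} = {0}"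
    by (auto simp: osc.span_singleton osc_delta_def zero_prod_def)
  ultimately show ?thesis by (auto simp: direct_sum_decomp_def)
qed

text \<open>Such a form lives on the line \<open>A/{t = 0}\<close> spanned by the class of \<open>\<delta>\<close>.\<close>

lemma form_on_quotient_line:
  assumes \<psi>: "sym_bilinear_form sc \<psi>" and 0: "\<And>a b. fst a = 0 \<Longrightarrow> \<psi> a b = 0"
  shows "\<psi> = (\<lambda>a b. \<psi> osc_delta osc_delta * (fst a * fst b))"
proof (intro ext)
  fix a b :: "'k \<times> 'v \<times> 'k"
  have sym: "\<psi> p q = \<psi> q p" for p q using \<psi> unfolding sym_bilinear_form_iff by blast
  have red: "\<psi> p q = fst p * \<psi> osc_delta q" for p q
  proof (cases p)
    case (fields t x s)
    have "p = sc t osc_delta + (0, x, s)" by (simp add: fields osc_delta_def)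
    then have "\<psi> p q = t * \<psi> osc_delta q + \<psi> (0, x, s) q"
      using \<psi> unfolding sym_bilinear_form_iff by metis
    then show ?thesis using 0[of "(0, x, s)" q] by (simp add: fields)
  qed
  show "\<psi> a b = \<psi> osc_delta osc_delta * (fst a * fst b)"
    using red[of a b] red[of b osc_delta] sym[of osc_delta b] by simp
qed

context
  assumes bij: "bij \<delta>"
begin

lemma delta_surj: obtains w where "x = \<delta> w"
  using bij by (metis bij_pointE)

lemma delta_eq_0 [simp]: "\<delta> v = 0 \<longleftrightarrow> v = 0"
  using bij_delta_iff bij delta_0 by blast

text \<open>For \<open>x \<noteq> 0\<close> also \<open>\<delta> x \<noteq> 0\<close>, and \<open>\<phi>\<close> is non-degenerate.\<close>

lemma star_is_bracket:
  obtains x y where "\<phi> (\<delta> x) y = 1" "br (0, x, 0) (0, y, 0) = (0, 0, 1)"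
proof -
  obtain x :: 'v where "x \<noteq> 0" by (rule nonzero_vector)
  then obtain y where "\<phi> (\<delta> x) y = 1" by (metis delta_eq_0 nonzero_pairing)
  then show ?thesis by (intro that[of x y]) auto
qed

lemma derived_eq: "lie_derived sc br UNIV = {a. fst a = 0}"
proof
  show "lie_derived sc br UNIV \<subseteq> {a. fst a = 0}"
    using lie_character_derived[OF fst_character] by blast
  have "(0, x, s) \<in> lie_derived sc br UNIV" for x s
  proof -
    have sub: "osc.subspace (lie_derived sc br UNIV)" by (simp add: lie_derived_def)
    have mem: "br a b \<in> lie_derived sc br UNIV" for a b
      unfolding lie_derived_def by (rule osc.span_base) blast
    obtain w where w: "x = \<delta> w" by (rule delta_surj)
    obtain p q where pq: "br (0, p, 0) (0, q, 0) = (0, 0, 1)" by (rule star_is_bracket)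
    have "(0, x, s) = br (1, 0, 0) (0, w, 0) + sc s (br (0, p, 0) (0, q, 0))"
      unfolding pq by (simp add: w)
    also have "\<dots> \<in> lie_derived sc br UNIV"
      by (intro osc.subspace_add[OF sub] osc.subspace_scale[OF sub] mem)
    finally show ?thesis .
  qed
  then show "{a. fst a = 0} \<subseteq> lie_derived sc br UNIV" by auto
qed

lemma centre_eq: "lie_centre br UNIV = osc.span {(0, 0, 1)}"
proof
  show "lie_centre br UNIV \<subseteq> osc.span {(0, 0, 1)}"
  proof
    fix z assume z: "z \<in> lie_centre br UNIV"
    obtain t x s where zt: "z = (t, x, s)" by (cases z)
    have c: "br z a = 0" for a using z unfolding lie_centre_def by blast
    have "x = 0" using c[of "(1, 0, 0)"] by (simp add: zt zero_prod_def)
    obtain v :: 'v where "v \<noteq> 0" by (rule nonzero_vector)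
    then have "t = 0" using c[of "(0, v, 0)"] by (simp add: zt zero_prod_def)
    then show "z \<in> osc.span {(0, 0, 1)}"
      by (auto simp: zt \<open>x = 0\<close> osc.span_singleton)
  qed
qed (auto simp: lie_centre_def osc.span_singleton zero_prod_def)

text \<open>Let \<open>m = (t, x, s)\<close> be in the ideal with \<open>t \<noteq> 0\<close>. Bracketing \<open>m\<close> with \<open>w \<in> V\<close> gives
  \<open>t \<delta> w\<close> up to a multiple of \<open>\<delta>\<^sup>*\<close>; bracketing again with \<open>V\<close> gives \<open>\<delta>\<^sup>*\<close>, so
  the ideal contains all of \<open>V\<close>, and removing the part of \<open>m\<close> in \<open>A\<^sup>2\<close> leaves \<open>t \<delta>\<close>.\<close>

lemma ideal_not_in_hyperplane:
  assumes J: "lie_ideal sc br UNIV J" and m: "m \<in> J" "fst m \<noteq> 0"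
  shows "J = UNIV"
proof -
  obtain t x s where mt: "m = (t, x, s)" by (cases m)
  have t: "t \<noteq> 0" using m(2) by (simp add: mt)
  have sub: "osc.subspace J" and brJ: "\<And>a b. b \<in> J \<Longrightarrow> br a b \<in> J"
    using J by (auto simp: lie_ideal_def)
  have scJ: "sc k a \<in> J" if "a \<in> J" for k a using osc.subspace_scale[OF sub that] .
  have addJ: "a + b \<in> J" if "a \<in> J" "b \<in> J" for a b using osc.subspace_add[OF sub that] .
  have V1: "\<exists>u. (0, \<delta> w, u) \<in> J" for w
  proof -
    have "sc (- 1 / t) (br (0, w, 0) m) = (0, \<delta> w, - 1 / t * \<phi> (\<delta> w) x)"
      using t by (simp add: mt)
    then show ?thesis using scJ[OF brJ[OF m(1)]] by metis
  qed
  obtain p q where pq: "\<phi> (\<delta> p) q = 1" by (rule star_is_bracket)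
  obtain w where "q = \<delta> w" by (rule delta_surj)
  with V1[of w] obtain u where "(0, q, u) \<in> J" by blast
  from brJ[OF this, of "(0, p, 0)"] have star: "(0, 0, 1) \<in> J" by (simp add: pq)
  have V: "(0, z, r) \<in> J" for z r
  proof -
    obtain w where w: "z = \<delta> w" by (rule delta_surj)
    with V1[of w] obtain u where "(0, z, u) \<in> J" by blast
    from addJ[OF this scJ[OF star, of "r - u"]] show ?thesis by simp
  qed
  have "(k, z, r) \<in> J" for k z r
    using addJ[OF scJ[OF m(1), of "k / t"] V[of "z - scale (k / t) x" "r - k / t * s"]] t
    by (simp add: mt)
  then show ?thesis by auto
qed

lemma unique_maximal_ideal: "\<exists>!I. maximal_lie_ideal sc br UNIV I"
proof (rule ex1I)
  show max: "maximal_lie_ideal sc br UNIV {a. fst a = 0}"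
    using lie_character_kernel_maximal[OF fst_character, of "(1, 0, 0)"] by simp
  fix I assume I: "maximal_lie_ideal sc br UNIV I"
  then have "I \<subseteq> {a. fst a = 0}"
    using ideal_not_in_hyperplane by (auto simp: maximal_lie_ideal_def)
  then show "I = {a. fst a = 0}"
    using I max by (auto simp: maximal_lie_ideal_def)
qed

lemma is_phi_1_0_iff:
  "is_phi_1_0 scale \<phi> \<delta> \<psi> \<longleftrightarrow> \<psi> = (\<lambda>a b. fst a * fst b)"
proof
  assume \<psi>: "is_phi_1_0 scale \<phi> \<delta> \<psi>"
  then have "sym_bilinear_form sc \<psi>" "\<And>a b. fst a = 0 \<Longrightarrow> \<psi> a b = 0"
    unfolding is_phi_1_0_def derived_eq by blast+
  then have "\<psi> = (\<lambda>a b. \<psi> osc_delta osc_delta * (fst a * fst b))"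
    by (rule form_on_quotient_line)
  then show "\<psi> = (\<lambda>a b. fst a * fst b)"
    using \<psi> by (simp add: is_phi_1_0_def)
next
  assume "\<psi> = (\<lambda>a b. fst a * fst b)"
  then show "is_phi_1_0 scale \<phi> \<delta> \<psi>"
    using lie_character_square[OF fst_character]
    by (simp add: is_phi_1_0_def derived_eq inv_sym_forms_def osc_delta_def)
qed

text \<open>An invariant form satisfies \<open>\<psi>([p, q], r) = -\<psi>(q, [p, r])\<close>. Expressing \<open>\<delta> w\<close> as
  \<open>[\<delta>, w]\<close> or \<open>-[w, \<delta>]\<close>, and \<open>\<delta>\<^sup>*\<close> as a bracket of vectors, determines \<open>\<psi>\<close> on
  \<open>A\<^sup>2 \<times> A\<close> in terms of the number \<open>\<psi>(\<delta>, \<delta>\<^sup>*)\<close>.\<close>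

lemma inv_sym_form_on_derived:
  assumes \<psi>: "\<psi> \<in> inv_sym_forms sc br" and a: "fst a = 0"
  shows "\<psi> a b = \<psi> (1, 0, 0) (0, 0, 1) * osc_form \<phi> a b"
proof -
  have inv: "\<psi> (br p q) r = - \<psi> q (br p r)" for p q r
    using \<psi> unfolding inv_sym_forms_def invariant_form_def eq_neg_iff_add_eq_0 by blast
  have add: "\<psi> (p + q) r = \<psi> p r + \<psi> q r" and scale: "\<psi> (sc k p) r = k * \<psi> p r"
    and sym: "\<psi> p r = \<psi> r p" for p q r k
    using \<psi> unfolding inv_sym_forms_def sym_bilinear_form_iff by blast+
  have add': "\<psi> r (p + q) = \<psi> r p + \<psi> r q" and scale': "\<psi> r (sc k p) = k * \<psi> r p" for p q r k
    using add[of p q r] scale[of k p r] by (simp_all add: sym)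
  have zero: "\<psi> r (0, 0, 0) = 0" for r using scale'[of r 0 "(0, 0, 0)"] by simp
  let ?c = "\<psi> (1, 0, 0) (0, 0, 1)"
  have V_star: "\<psi> (0, x, 0) (0, 0, 1) = 0" and V_delta: "\<psi> (0, x, 0) (1, 0, 0) = 0"
    and V_V: "\<psi> (0, x, 0) (0, y, 0) = ?c * \<phi> x y" for x y
  proof -
    obtain w where w: "x = \<delta> w" by (rule delta_surj)
    show "\<psi> (0, x, 0) (0, 0, 1) = 0"
      using inv[of "(1, 0, 0)" "(0, w, 0)" "(0, 0, 1)"] by (simp add: w zero)
    show "\<psi> (0, x, 0) (1, 0, 0) = 0"
      using inv[of "(1, 0, 0)" "(0, w, 0)" "(1, 0, 0)"] by (simp add: w zero)
    have "\<psi> (0, x, 0) (0, y, 0) = - \<psi> (br (0, w, 0) (1, 0, 0)) (0, y, 0)"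
      using scale[of "- 1" "(0, x, 0)" "(0, y, 0)"] by (simp add: w)
    also have "\<dots> = \<psi> (1, 0, 0) (0, 0, \<phi> x y)"
      unfolding inv by (simp add: w)
    also have "\<dots> = ?c * \<phi> x y"
      using scale'[of "(1, 0, 0)" "\<phi> x y" "(0, 0, 1)"] by simp
    finally show "\<psi> (0, x, 0) (0, y, 0) = ?c * \<phi> x y" .
  qed
  have star_star: "\<psi> (0, 0, 1) (0, 0, 1) = 0"
  proof -
    obtain p q where pq: "br (0, p, 0) (0, q, 0) = (0, 0, 1)" by (rule star_is_bracket)
    show ?thesis using inv[of "(0, p, 0)" "(0, q, 0)" "(0, 0, 1)"] unfolding pq by (simp add: zero)
  qed
  obtain x s where ax: "a = (0, x, s)" using a by (cases a) auto
  obtain t' y s' where b: "b = (t', y, s')" by (cases b)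
  have a': "a = (0, x, 0) + sc s (0, 0, 1)" by (simp add: ax)
  have b': "b = sc t' (1, 0, 0) + ((0, y, 0) + sc s' (0, 0, 1))" by (simp add: b)
  have "\<psi> a b = ?c * \<phi> x y + s * (t' * ?c)"
    unfolding a' b' add scale add' scale'
    by (simp only: V_star V_delta V_V star_star sym[of "(0, 0, 1)" "(1, 0, 0)"]
        sym[of "(0, 0, 1)" "(0, y, 0)"]) (simp add: algebra_simps)
  then show ?thesis by (simp add: ax b osc_form_def algebra_simps)
qed

lemma inv_sym_forms_eq_span:
  "inv_sym_forms sc br = forms.span {\<lambda>a b. fst a * fst b, osc_form \<phi>}"
proof
  let ?T = "\<lambda>(a :: 'k \<times> 'v \<times> 'k) (b :: 'k \<times> 'v \<times> 'k). fst a * fst b"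
  have sub: "forms.subspace (inv_sym_forms sc br)"
    by (rule subspace_inv_sym_forms[OF vector_space_osc])
  have osc: "osc_form \<phi> \<in> inv_sym_forms sc br"
    using osc_form_sym_bilinear osc_form_invariant by (simp add: inv_sym_forms_def)
  show "forms.span {?T, osc_form \<phi>} \<subseteq> inv_sym_forms sc br"
    using osc lie_character_square[OF fst_character] sub by (intro forms.span_minimal) auto
  show "inv_sym_forms sc br \<subseteq> forms.span {?T, osc_form \<phi>}"
  proof
    fix \<psi> assume \<psi>: "\<psi> \<in> inv_sym_forms sc br"
    define c where "c = \<psi> (1, 0, 0) (0, 0, 1)"
    define \<chi> where "\<chi> = \<psi> - form_scale c (osc_form \<phi>)"
    have "\<chi> \<in> inv_sym_forms sc br"
      unfolding \<chi>_def using \<psi> osc by (intro forms.subspace_diff[OF sub] forms.subspace_scale[OF sub])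
    then have "sym_bilinear_form sc \<chi>" by (simp add: inv_sym_forms_def)
    moreover have "\<chi> a b = 0" if "fst a = 0" for a b
      using inv_sym_form_on_derived[OF \<psi> that, of b] by (simp add: \<chi>_def c_def form_scale_def)
    ultimately have "\<chi> = form_scale (\<chi> osc_delta osc_delta) ?T"
      unfolding form_scale_def by (rule form_on_quotient_line)
    then have "\<psi> = form_scale (\<chi> osc_delta osc_delta) ?T + form_scale c (osc_form \<phi>)"
      by (metis \<chi>_def diff_add_cancel)
    then show "\<psi> \<in> forms.span {?T, osc_form \<phi>}"
      by (metis forms.span_add forms.span_scale forms.span_base insertI1 insertI2)
  qed
qed

lemma quadratic_dim_eq_2: "quadratic_dim sc br = 2"
proof -
  let ?T = "\<lambda>(a :: 'k \<times> 'v \<times> 'k) (b :: 'k \<times> 'v \<times> 'k). fst a * fst b"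
  have 0: "osc_form \<phi> (1, 0, 0) (0, 0, 1) \<noteq> 0" by (simp add: osc_form_def)
  then have "osc_form \<phi> \<noteq> 0" by auto
  moreover have "?T \<noteq> form_scale k (osc_form \<phi>)" for k
  proof
    assume eq: "?T = form_scale k (osc_form \<phi>)"
    have "k = 0" using fun_cong[OF fun_cong[OF eq], of "(1, 0, 0)" "(0, 0, 1)"]
      by (simp add: form_scale_def osc_form_def)
    then show False using fun_cong[OF fun_cong[OF eq], of "(1, 0, 0)" "(1, 0, 0)"]
      by (simp add: form_scale_def)
  qed
  ultimately have "forms.independent {?T, osc_form \<phi>}" "?T \<noteq> osc_form \<phi>"
    by (rule forms.independent_pairI)+
  then show ?thesis
    unfolding quadratic_dim_def inv_sym_forms_eq_span
    by (simp add: forms.dim_eq_card_independent)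
qed

lemma derived_heisenberg:
  assumes "CHAR('k) \<noteq> 2"
  shows "generalized_heisenberg sc br (lie_derived sc br UNIV)"
proof -
  let ?H = "{a :: 'k \<times> 'v \<times> 'k. fst a = 0}"
  let ?z = "(0, 0, 1) :: 'k \<times> 'v \<times> 'k"
  have "lie_algebra sc br ?H"
    by (rule lie_subalgebra[OF oscillator_lie_algebra[OF assms]])
      (auto intro!: osc.subspaceI)
  moreover have "lie_derived sc br ?H = osc.span {?z}"
  proof
    show "lie_derived sc br ?H \<subseteq> osc.span {?z}"
      unfolding lie_derived_def
      by (rule osc.span_minimal[OF _ osc.subspace_span]) (auto simp: osc.span_singleton)
    obtain p q where "br (0, p, 0) (0, q, 0) = ?z" by (rule star_is_bracket)
    then have "?z \<in> {br x y |x y. x \<in> ?H \<and> y \<in> ?H}"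
      by (metis (mono_tags, lifting) fst_conv mem_Collect_eq)
    then show "osc.span {?z} \<subseteq> lie_derived sc br ?H"
      unfolding lie_derived_def by (intro osc.span_mono) auto
  qed
  moreover have "lie_centre br ?H = osc.span {?z}"
  proof
    show "lie_centre br ?H \<subseteq> osc.span {?z}"
    proof
      fix a assume a: "a \<in> lie_centre br ?H"
      then obtain x s where ax: "a = (0, x, s)" by (cases a) (auto simp: lie_centre_def)
      have "\<phi> (\<delta> x) y = 0" for y
      proof -
        have "br a (0, y, 0) = 0" using a by (simp add: lie_centre_def)
        then show ?thesis by (simp add: ax zero_prod_def)
      qed
      then have "x = 0" using nonzero_pairing[of "\<delta> x"] by (metis delta_eq_0 zero_neq_one)
      then show "a \<in> osc.span {?z}" by (auto simp: ax osc.span_singleton)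
    qed
  qed (auto simp: lie_centre_def osc.span_singleton zero_prod_def)
  moreover have "?z \<noteq> 0" by (simp add: zero_prod_def)
  ultimately show ?thesis
    unfolding generalized_heisenberg_def derived_eq by blast
qed

end

end

section \<open>The equivalences\<close>

theorem lemma3p7:
  fixes scale :: "'k::field \<Rightarrow> 'v::ab_group_add \<Rightarrow> 'v"
    and \<phi> :: "'v \<Rightarrow> 'v \<Rightarrow> 'k" and \<delta> :: "'v \<Rightarrow> 'v"
  assumes "CHAR('k) \<noteq> 2"
    and "generalized_oscillator scale \<phi> \<delta>"
  shows
    "let sc = osc_scale scale;
         br = osc_bracket scale \<phi> \<delta>;
         A = (UNIV :: ('k \<times> 'v \<times> 'k) set);
         A2 = lie_derived sc br A;
         a = local_lie_algebra sc br A;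
         b = (direct_sum_decomp A A2 (module.span sc {osc_delta}) \<and> \<delta> \<noteq> (\<lambda>x. 0));
         c = (vector_space.dim sc (lie_centre br A) = 1);
         d = (Vector_Spaces.linear scale scale \<delta> \<and> bij \<delta>);
         e = (quadratic_dim sc br = 2)
     in (a \<longleftrightarrow> b) \<and> (a \<longleftrightarrow> c) \<and> (a \<longleftrightarrow> d) \<and> (a \<longleftrightarrow> e) \<and>
        (a \<longrightarrow>
           generalized_heisenberg sc br A2 \<and>
           (\<exists>!\<psi>. is_phi_1_0 scale \<phi> \<delta> \<psi>) \<and>
           (\<forall>\<psi>. is_phi_1_0 scale \<phi> \<delta> \<psi> \<longrightarrow>
              inv_sym_forms sc br = module.span form_scale {\<psi>, osc_form \<phi>}))"
proof -
  interpret generalized_oscillator scale \<phi> \<delta> by fact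
  have lie: "lie_algebra (osc_scale scale) (osc_bracket scale \<phi> \<delta>) UNIV"
    by (rule oscillator_lie_algebra) fact
  show ?thesis
  proof (cases "bij \<delta>")
    case True
    obtain x :: 'v where "x \<noteq> 0" by (rule nonzero_vector)
    then have "\<delta> x \<noteq> 0" using True by (simp add: delta_eq_0)
    then have "\<delta> \<noteq> (\<lambda>x. 0)" by auto
    moreover have "osc.dim (lie_centre br UNIV) = 1"
    proof -
      have "osc.independent {(0, 0, 1)}" by (simp add: zero_prod_def)
      then show ?thesis by (simp add: centre_eq[OF True] osc.dim_eq_card_independent)
    qed
    ultimately show ?thesis
      using lie lin True unique_maximal_ideal[OF True] hyperplane_eq_span_delta
        quadratic_dim_eq_2[OF True] derived_heisenberg[OF True assms(1)]
      by (simp add: Let_def local_lie_algebra_def derived_eq[OF True] is_phi_1_0_iff[OF True]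
          inv_sym_forms_eq_span[OF True])
  next
    case False
    then obtain v where "v \<noteq> 0" "\<delta> v = 0" using bij_delta_iff by blast
    from kernel_vector_refutes[OF this] False show ?thesis by (simp add: Let_def)
  qed
qed

end
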